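(* Let $\mathcal{A}$ be a (commutative) unique factorization domain that is a $\mathbb{C}$-algebra, and let $\sigma$ be an endomorphism of $\mathcal{A}$ with $\sigma\neq\mathrm{id}$. Set $g=\gcd\big((\mathrm{id}-\sigma)(\mathcal{A})\big)$. Then: 1. $\mathcal{D}_\sigma(\mathcal{A})=\mathcal{A}\Delta$, with $\Delta=\dfrac{\mathrm{id}-\sigma}{g}$; 2. for $a\in\mathcal{A}$, the $\sigma$-derivation $a\Delta$ is inner if and only if $g$ divides $a$. In other words, $\mathcal{I}nn_\sigma(\mathcal{A})=g\mathcal{A}\Delta$.
   Context: Algebras are associative unital $\mathbb{C}$-algebras, and endomorphisms are unital $\mathbb{C}$-algebra endomorphisms. A $\sigma$-derivation of $\mathcal{A}$ is a $\mathbb{C}$-linear map $D:\mathcal{A}\to\mathcal{A}$ with $D(ab)=\sigma(a)D(b)+D(a)b$ for all $a,b\in\mathcal{A}$; $\mathcal{D}_\sigma(\mathcal{A})$ is the set of all of them, a left $\mathcal{A}$-module via $(a\Delta)(r)=a\Delta(r)$. A $\sigma$-derivation is inner if it equals $p(\mathrm{id}-\sigma): r\mapsto p(r-\sigma(r))$ for some $p\in\mathcal{A}$; $\mathcal{I}nn_\sigma(\mathcal{A})$ is the set of inner $\sigma$-derivations. The element $g$ is a greatest common divisor of the set $\{r-\sigma(r) : r\in\mathcal{A}\}$ (defined up to a unit; one choice is fixed), and $\Delta(r)=(r-\sigma(r))/g$. *)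

theory Defs
  imports Complex_Main "HOL-Computational_Algebra.Factorial_Ring"
begin

locale complex_algebra = vector_space scale
  for scale :: "complex \<Rightarrow> 'a::ring_1 \<Rightarrow> 'a" +
  assumes scale_mult_left: "scale c (x * y) = scale c x * y"
    and scale_mult_right: "scale c (x * y) = x * scale c y"

definition algebra_endo :: "(complex \<Rightarrow> 'a::ring_1 \<Rightarrow> 'a) \<Rightarrow> ('a \<Rightarrow> 'a) \<Rightarrow> bool" where
  "algebra_endo scale \<sigma> \<longleftrightarrow>
     Vector_Spaces.linear scale scale \<sigma> \<and> (\<forall>a b. \<sigma> (a * b) = \<sigma> a * \<sigma> b) \<and> \<sigma> 1 = 1"

definition sigma_derivations ::
    "(complex \<Rightarrow> 'a::ring_1 \<Rightarrow> 'a) \<Rightarrow> ('a \<Rightarrow> 'a) \<Rightarrow> ('a \<Rightarrow> 'a) set" where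
  "sigma_derivations scale \<sigma> =
     {D. Vector_Spaces.linear scale scale D \<and> (\<forall>a b. D (a * b) = \<sigma> a * D b + D a * b)}"

definition left_act :: "'a::ring_1 \<Rightarrow> ('a \<Rightarrow> 'a) \<Rightarrow> 'a \<Rightarrow> 'a" where
  "left_act a D = (\<lambda>r. a * D r)"

definition inner_sigma_derivations ::
    "(complex \<Rightarrow> 'a::ring_1 \<Rightarrow> 'a) \<Rightarrow> ('a \<Rightarrow> 'a) \<Rightarrow> ('a \<Rightarrow> 'a) set" where
  "inner_sigma_derivations scale \<sigma> =
     {D \<in> sigma_derivations scale \<sigma>. \<exists>p. D = left_act p (\<lambda>r. r - \<sigma> r)}"

(* Only defined up to a unit, so a predicate rather than the normalised choice made by Gcd. *)
definition is_gcd_of_set :: "'a::comm_monoid_mult \<Rightarrow> 'a set \<Rightarrow> bool" where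
  "is_gcd_of_set g S \<longleftrightarrow> (\<forall>s\<in>S. g dvd s) \<and> (\<forall>d. (\<forall>s\<in>S. d dvd s) \<longrightarrow> d dvd g)"

lemma ex_gcd_of_set:
  fixes S :: "'a::factorial_semiring set"
  shows "\<exists>g. is_gcd_of_set g S"
proof -
  have "is_gcd_of_set (Gcd_factorial S) S"
    unfolding is_gcd_of_set_def
    by (metis Gcd_factorial_dvd Gcd_factorial_greatest dvd_normalize_iff)
  then show ?thesis ..
qed

(* The division is exact when g is a gcd of {r - \<sigma> r | r} and g is nonzero. *)
definition sigma_Delta :: "('a::idom_divide \<Rightarrow> 'a) \<Rightarrow> 'a \<Rightarrow> 'a \<Rightarrow> 'a" where
  "sigma_Delta \<sigma> g = (\<lambda>r. (r - \<sigma> r) div g)"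

end

theory Submission imports Defs begin

text \<open>
  Commutativity is what makes all twisted derivations proportional: expanding \<open>D (a * b) = D (b * a)\<close>
  by the twisted Leibniz rule in both orders gives
  \<open>(a - \<sigma> a) * D b = (b - \<sigma> b) * D a\<close> (lemma \<open>twisted_derivation_exchange\<close>).
  Since \<open>\<sigma> \<noteq> id\<close>, there is \<open>r0\<close> with \<open>r0 - \<sigma> r0 \<noteq> 0\<close>. By the exchange identity, this element divides
  \<open>(r - \<sigma> r) * D r0\<close> for every \<open>r\<close>. In a factorial domain, multiplying a set by \<open>c\<close> multiplies its
  greatest common divisor by \<open>c\<close> (lemma \<open>dvd_gcd_of_set_mult\<close>), hence \<open>r0 - \<sigma> r0\<close> divides
  \<open>g * D r0\<close>. The quotient \<open>a\<close> is the coefficient of \<open>D\<close>: cancelling \<open>r0 - \<sigma> r0\<close> in the exchange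
  identity gives \<open>D r = a * \<Delta> r\<close>, where \<open>g * \<Delta> r = r - \<sigma> r\<close>.

  The inner derivation with coefficient \<open>p\<close> is \<open>p * g\<close> times \<open>\<Delta>\<close>, and the coefficient of a multiple
  of \<open>\<Delta>\<close> is unique because \<open>\<Delta> r0 \<noteq> 0\<close>. Hence the inner derivations correspond exactly to
  the coefficients divisible by \<open>g\<close>.
\<close>

text \<open>
  Each prime factor of a divisor of \<open>s * c\<close> either divides \<open>c\<close>, and is charged to it, or divides
  \<open>s\<close>. The decision depends only on \<open>c\<close>, and so one splitting serves all \<open>s \<in> S\<close> at once.
\<close>

lemma dvd_mult_common_split:
  fixes x c :: "'a::factorial_semiring"
  assumes "x \<noteq> 0" and "\<And>s. s \<in> S \<Longrightarrow> x dvd s * c"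
  shows "\<exists>d e. x = d * e \<and> (\<forall>s\<in>S. d dvd s) \<and> e dvd c"
  using assms
proof (induction x arbitrary: c S rule: prime_divisors_induct)
  case zero
  then show ?case by simp
next
  case (unit x)
  then show ?case
    by (metis mult_1 one_dvd unit_imp_dvd)
next
  case (factor p x)
  have p0: "p \<noteq> 0" and x0: "x \<noteq> 0"
    using factor.prems(1) by auto
  show ?case
  proof (cases "p dvd c")
    case True
    then obtain c' where c: "c = p * c'" ..
    have "x dvd s * c'" if "s \<in> S" for s
      using factor.prems(2)[OF that] p0 by (simp add: c mult.left_commute)
    from factor.IH[OF x0 this] obtain d e
      where "x = d * e" "\<forall>s\<in>S. d dvd s" "e dvd c'" by blast
    then have "p * x = d * (p * e)" "\<forall>s\<in>S. d dvd s" "p * e dvd c"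
      by (auto simp: c mult.left_commute intro: mult_dvd_mono)
    then show ?thesis by blast
  next
    case False
    have p_dvd: "p dvd s" if "s \<in> S" for s
      using factor.prems(2)[OF that] factor.hyps False
      by (meson dvd_mult_left prime_dvd_mult_iff)
    have "x dvd t * c" if "t \<in> {t. p * t \<in> S}" for t
      using factor.prems(2)[of "p * t"] that p0 by (simp add: mult.assoc)
    from factor.IH[OF x0 this] obtain d e
      where de: "x = d * e" "\<forall>t\<in>{t. p * t \<in> S}. d dvd t" "e dvd c" by blast
    have "p * d dvd s" if "s \<in> S" for s
      using p_dvd[OF that] de(2) that by (auto elim!: dvdE[of p] intro: mult_dvd_mono)
    moreover have "p * x = (p * d) * e"
      by (simp add: de(1) mult.assoc)
    ultimately show ?thesis using de(3) by blast
  qed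
qed

lemma dvd_gcd_of_set_mult:
  fixes x c g :: "'a::factorial_semiring"
  assumes "is_gcd_of_set g S" and "x \<noteq> 0" and "\<And>s. s \<in> S \<Longrightarrow> x dvd s * c"
  shows "x dvd g * c"
proof -
  obtain d e where "x = d * e" "\<forall>s\<in>S. d dvd s" "e dvd c"
    using dvd_mult_common_split[OF assms(2,3)] by blast
  then show ?thesis
    using assms(1) by (auto simp: is_gcd_of_set_def intro: mult_dvd_mono)
qed

lemma twisted_derivation_exchange:
  fixes D \<sigma> :: "'a::comm_ring_1 \<Rightarrow> 'a"
  assumes "\<And>a b. D (a * b) = \<sigma> a * D b + D a * b"
  shows "(a - \<sigma> a) * D b = (b - \<sigma> b) * D a"
  using assms[of a b] assms[of b a] by (simp add: algebra_simps)

lemma left_act_sigma_derivation: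
  fixes scale :: "complex \<Rightarrow> 'a::comm_ring_1 \<Rightarrow> 'a"
  assumes alg: "complex_algebra scale" and D: "D \<in> sigma_derivations scale \<sigma>"
  shows "left_act a D \<in> sigma_derivations scale \<sigma>"
proof -
  have "a * D (scale c x) = scale c (a * D x)" for c x
    using D complex_algebra.scale_mult_right[OF alg]
    by (simp add: sigma_derivations_def Vector_Spaces.linear_iff)
  then show ?thesis
    using D by (simp add: sigma_derivations_def left_act_def Vector_Spaces.linear_iff algebra_simps)
qed

text \<open>
  The twisted Leibniz rule for \<open>id - \<sigma>\<close> is the identity
  \<open>a * b - \<sigma> a * \<sigma> b = \<sigma> a * (b - \<sigma> b) + (a - \<sigma> a) * b\<close>; an exact quotient inherits
  it, since \<open>g\<close> can be cancelled.
\<close>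

lemma quotient_sigma_derivation:
  fixes scale :: "complex \<Rightarrow> 'a::idom \<Rightarrow> 'a"
  assumes alg: "complex_algebra scale" and endo: "algebra_endo scale \<sigma>"
    and "g \<noteq> 0" and q: "\<And>r. g * q r = r - \<sigma> r"
  shows "q \<in> sigma_derivations scale \<sigma>"
proof -
  interpret complex_algebra scale by (fact alg)
  have cancel: "x = y" if "g * x = g * y" for x y
    using that \<open>g \<noteq> 0\<close> by simp
  have \<sigma>: "\<sigma> (x + y) = \<sigma> x + \<sigma> y" "\<sigma> (scale c x) = scale c (\<sigma> x)" "\<sigma> (x * y) = \<sigma> x * \<sigma> y"
    for x y c
    using endo by (simp_all add: algebra_endo_def Vector_Spaces.linear_iff)
  have "q (x + y) = q x + q y" for x y
    by (rule cancel) (simp add: distrib_left q \<sigma>)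
  moreover have "q (scale c x) = scale c (q x)" for c x
    by (rule cancel) (simp add: q \<sigma> scale_mult_right[symmetric] scale_right_diff_distrib)
  moreover have "q (x * y) = \<sigma> x * q y + q x * y" for x y
  proof (rule cancel)
    have "g * (\<sigma> x * q y + q x * y) = \<sigma> x * (g * q y) + (g * q x) * y"
      by (simp add: algebra_simps)
    also have "\<dots> = \<sigma> x * (y - \<sigma> y) + (x - \<sigma> x) * y"
      by (simp only: q)
    also have "\<dots> = g * q (x * y)"
      by (simp add: q \<sigma> algebra_simps)
    finally show "g * q (x * y) = g * (\<sigma> x * q y + q x * y)" ..
  qed
  ultimately show ?thesis
    by (simp add: sigma_derivations_def Vector_Spaces.linear_iff vector_space_axioms)
qed

lemma sigma_derivation_coefficient:
  fixes D \<sigma> q :: "'a::{factorial_semiring, idom_divide} \<Rightarrow> 'a"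
  assumes gcd: "is_gcd_of_set g (range (\<lambda>r. r - \<sigma> r))"
    and q: "\<And>r. g * q r = r - \<sigma> r" and r0: "r0 - \<sigma> r0 \<noteq> 0"
    and D: "\<And>a b. D (a * b) = \<sigma> a * D b + D a * b"
  shows "\<exists>a. D = left_act a q"
proof -
  note exchange = twisted_derivation_exchange[where D = D and \<sigma> = \<sigma>, OF D]
  have "r0 - \<sigma> r0 dvd s * D r0" if "s \<in> range (\<lambda>r. r - \<sigma> r)" for s
  proof -
    from that obtain r where "s = r - \<sigma> r" ..
    then show ?thesis by (simp only: exchange[of r r0] dvd_triv_left)
  qed
  from dvd_gcd_of_set_mult[OF gcd r0 this]
  obtain a where a: "g * D r0 = (r0 - \<sigma> r0) * a" ..
  have "D r = a * q r" for r
  proof -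
    have "(r0 - \<sigma> r0) * D r = (g * D r0) * q r"
      by (simp only: exchange[of r0 r] q[of r, symmetric]) (simp only: mult_ac)
    then have "(r0 - \<sigma> r0) * D r = (r0 - \<sigma> r0) * (a * q r)"
      by (simp only: a mult.assoc)
    then show ?thesis using r0 by simp
  qed
  then show ?thesis by (auto simp: left_act_def)
qed

theorem proposition3p1:
  fixes scale :: "complex \<Rightarrow> 'a::{factorial_semiring, idom_divide} \<Rightarrow> 'a"
    and \<sigma> :: "'a \<Rightarrow> 'a" and g :: 'a
  assumes "complex_algebra scale"
    and "algebra_endo scale \<sigma>"
    and "\<sigma> \<noteq> id"
    and "is_gcd_of_set g (range (\<lambda>r. r - \<sigma> r))"
  shows "sigma_derivations scale \<sigma> = {left_act a (sigma_Delta \<sigma> g) | a. True}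
    \<and> (\<forall>a. left_act a (sigma_Delta \<sigma> g) \<in> inner_sigma_derivations scale \<sigma> \<longleftrightarrow> g dvd a)
    \<and> inner_sigma_derivations scale \<sigma> = {left_act (g * a) (sigma_Delta \<sigma> g) | a. True}"
proof -
  let ?\<Delta> = "sigma_Delta \<sigma> g"
  from \<open>\<sigma> \<noteq> id\<close> obtain r0 where r0: "r0 - \<sigma> r0 \<noteq> 0"
    by fastforce
  have \<Delta>: "g * ?\<Delta> r = r - \<sigma> r" for r
    using assms(4) by (simp add: sigma_Delta_def is_gcd_of_set_def)
  have "g \<noteq> 0" and \<Delta>0: "?\<Delta> r0 \<noteq> 0"
    using \<Delta>[of r0] r0 by auto
  have mult_\<Delta>: "left_act a ?\<Delta> \<in> sigma_derivations scale \<sigma>" for a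
    by (intro left_act_sigma_derivation quotient_sigma_derivation[OF _ _ \<open>g \<noteq> 0\<close> \<Delta>] assms)
  have derivations: "sigma_derivations scale \<sigma> = {left_act a ?\<Delta> | a. True}"
    using mult_\<Delta> sigma_derivation_coefficient[OF assms(4) \<Delta> r0]
    by (fastforce simp: sigma_derivations_def)
  have inner_eq: "left_act p (\<lambda>r. r - \<sigma> r) = left_act (g * p) ?\<Delta>" for p
    by (simp add: left_act_def \<Delta>[symmetric] mult_ac)
  have inner: "inner_sigma_derivations scale \<sigma> = {left_act (g * a) ?\<Delta> | a. True}"
    using mult_\<Delta> by (auto simp: inner_sigma_derivations_def inner_eq)
  have coefficient_unique: "a = b" if "left_act a ?\<Delta> = left_act b ?\<Delta>" for a b
    using fun_cong[OF that, of r0] \<Delta>0 by (simp add: left_act_def)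
  have "left_act a ?\<Delta> \<in> inner_sigma_derivations scale \<sigma> \<longleftrightarrow> g dvd a" for a
    by (auto simp: inner dvd_def dest: coefficient_unique)
  with derivations inner show ?thesis by blast
qed

end
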